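(* Let $\mathsf{K}$ be an essentially small triangulated category. If the lattice $\mathrm{Thick}(\mathsf{K})$ of thick subcategories of $\mathsf{K}$ is distributive, then there is a sober topological space, namely $X=\mathrm{Spec}\,\mathrm{Thick}(\mathsf{K})$ (the space of meet-prime thick subcategories of $\mathsf{K}$), such that $\mathrm{Thick}(\mathsf{K})$ is isomorphic to the lattice of open subsets of $X$.
   Context: A thick subcategory of a triangulated category $\mathsf{K}$ is a full subcategory closed under isomorphisms, all suspensions, cones and direct summands. $\mathrm{Thick}(\mathsf{K})$ is the complete lattice of thick subcategories ordered by inclusion, with meets given by intersection and the join of a family given by the smallest thick subcategory containing its union. An element $\mathfrak{p}\neq 1$ of a lattice $L$ is meet-prime if $l\wedge m\le \mathfrak{p}$ implies $l\le\mathfrak{p}$ or $m\le \mathfrak{p}$. For a complete lattice $L$, $\mathrm{Spec}(L)$ is the set of poset maps $p\colon L\to\mathbf{2}=\{0\le1\}$ preserving finite meets and arbitrary joins (hence top and bottom), with open subsets $U_l=\{p\mid p(l)=1\}$ for $l\in L$. Such maps correspond bijectively to meet-prime elements $\mathfrak{p}$ of $L$ via $p(a)=0\iff a\le\mathfrak{p}$. A space is sober if every irreducible closed subset has a unique generic point. *)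

theory Defs
  imports
    "HOL-Algebra.Complete_Lattice"
    "HOL-Algebra.Group"
    "HOL-Analysis.Abstract_Topology"
begin

section \<open>Categories\<close>

text \<open>Objects and morphisms form sets over arbitrary types, so every category below is small. An
  essentially small triangulated category is represented by an equivalent small one; thick
  subcategories are closed under isomorphism, so the lattice they form is unchanged.\<close>

record ('o, 'm) category =
  Ob :: "'o set"
  Mor :: "'m set"
  src :: "'m \<Rightarrow> 'o"
  tgt :: "'m \<Rightarrow> 'o"
  ident :: "'o \<Rightarrow> 'm"
  comp :: "'m \<Rightarrow> 'm \<Rightarrow> 'm" (infixl \<open>\<odot>\<index>\<close> 70)

definition Hom :: "('o, 'm, 'z) category_scheme \<Rightarrow> 'o \<Rightarrow> 'o \<Rightarrow> 'm set"
  where "Hom C X Y = {f \<in> Mor C. src C f = X \<and> tgt C f = Y}"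

locale category =
  fixes C :: "('o, 'm, 'z) category_scheme" (structure)
  assumes src_closed: "f \<in> Mor C \<Longrightarrow> src C f \<in> Ob C"
    and tgt_closed: "f \<in> Mor C \<Longrightarrow> tgt C f \<in> Ob C"
    and ident_closed: "X \<in> Ob C \<Longrightarrow> ident C X \<in> Hom C X X"
    and comp_closed: "\<lbrakk>f \<in> Hom C X Y; g \<in> Hom C Y Z\<rbrakk> \<Longrightarrow> g \<odot> f \<in> Hom C X Z"
    and comp_ident: "f \<in> Hom C X Y \<Longrightarrow> f \<odot> ident C X = f"
    and ident_comp: "f \<in> Hom C X Y \<Longrightarrow> ident C Y \<odot> f = f"
    and comp_assoc:
      "\<lbrakk>f \<in> Hom C W X; g \<in> Hom C X Y; h \<in> Hom C Y Z\<rbrakk> \<Longrightarrow> h \<odot> (g \<odot> f) = (h \<odot> g) \<odot> f"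

definition iso_mor :: "('o, 'm, 'z) category_scheme \<Rightarrow> 'o \<Rightarrow> 'o \<Rightarrow> 'm \<Rightarrow> bool"
  where "iso_mor C X Y f \<longleftrightarrow> f \<in> Hom C X Y \<and>
    (\<exists>g \<in> Hom C Y X. g \<odot>\<^bsub>C\<^esub> f = ident C X \<and> f \<odot>\<^bsub>C\<^esub> g = ident C Y)"

definition iso_obj :: "('o, 'm, 'z) category_scheme \<Rightarrow> 'o \<Rightarrow> 'o \<Rightarrow> bool"
  where "iso_obj C X Y \<longleftrightarrow> (\<exists>f. iso_mor C X Y f)"

definition zero_obj :: "('o, 'm, 'z) category_scheme \<Rightarrow> 'o \<Rightarrow> bool"
  where "zero_obj C Z \<longleftrightarrow> Z \<in> Ob C \<and>
    (\<forall>X \<in> Ob C. (\<exists>!f. f \<in> Hom C X Z) \<and> (\<exists>!f. f \<in> Hom C Z X))"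

definition endofunctor ::
    "('o, 'm, 'z) category_scheme \<Rightarrow> ('o \<Rightarrow> 'o) \<Rightarrow> ('m \<Rightarrow> 'm) \<Rightarrow> bool"
  where "endofunctor C Fo Fm \<longleftrightarrow>
    (\<forall>X \<in> Ob C. Fo X \<in> Ob C \<and> Fm (ident C X) = ident C (Fo X)) \<and>
    (\<forall>X Y. \<forall>f \<in> Hom C X Y. Fm f \<in> Hom C (Fo X) (Fo Y)) \<and>
    (\<forall>X Y Z. \<forall>f \<in> Hom C X Y. \<forall>g \<in> Hom C Y Z. Fm (g \<odot>\<^bsub>C\<^esub> f) = Fm g \<odot>\<^bsub>C\<^esub> Fm f)"

definition natural_iso ::
    "('o, 'm, 'z) category_scheme \<Rightarrow> ('o \<Rightarrow> 'o) \<Rightarrow> ('m \<Rightarrow> 'm) \<Rightarrow> ('o \<Rightarrow> 'o) \<Rightarrow> ('m \<Rightarrow> 'm) \<Rightarrow>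
      ('o \<Rightarrow> 'm) \<Rightarrow> bool"
  where "natural_iso C Fo Fm Go Gm \<eta> \<longleftrightarrow>
    (\<forall>X \<in> Ob C. iso_mor C (Fo X) (Go X) (\<eta> X)) \<and>
    (\<forall>X Y. \<forall>f \<in> Hom C X Y. Gm f \<odot>\<^bsub>C\<^esub> \<eta> X = \<eta> Y \<odot>\<^bsub>C\<^esub> Fm f)"

definition autoequivalence ::
    "('o, 'm, 'z) category_scheme \<Rightarrow> ('o \<Rightarrow> 'o) \<Rightarrow> ('m \<Rightarrow> 'm) \<Rightarrow> bool"
  where "autoequivalence C Fo Fm \<longleftrightarrow> endofunctor C Fo Fm \<and>
    (\<exists>Go Gm. endofunctor C Go Gm \<and>
      (\<exists>\<eta>. natural_iso C id id (Go \<circ> Fo) (Gm \<circ> Fm) \<eta>) \<and>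
      (\<exists>\<epsilon>. natural_iso C (Fo \<circ> Go) (Fm \<circ> Gm) id id \<epsilon>))"

section \<open>Additive categories\<close>

record ('o, 'm) preadditive_category = "('o, 'm) category" +
  plus_mor :: "'m \<Rightarrow> 'm \<Rightarrow> 'm"
  zero_mor :: "'o \<Rightarrow> 'o \<Rightarrow> 'm"

definition hom_group ::
    "('o, 'm, 'z) preadditive_category_scheme \<Rightarrow> 'o \<Rightarrow> 'o \<Rightarrow> 'm monoid"
  where "hom_group C X Y =
    \<lparr>carrier = Hom C X Y, mult = plus_mor C, one = zero_mor C X Y\<rparr>"

definition neg_mor :: "('o, 'm, 'z) preadditive_category_scheme \<Rightarrow> 'm \<Rightarrow> 'm"
  where "neg_mor C f = m_inv (hom_group C (src C f) (tgt C f)) f"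

locale preadditive_category = category C
  for C :: "('o, 'm, 'z) preadditive_category_scheme" (structure) +
  assumes hom_comm_group: "\<lbrakk>X \<in> Ob C; Y \<in> Ob C\<rbrakk> \<Longrightarrow> comm_group (hom_group C X Y)"
    and comp_plus: "\<lbrakk>f \<in> Hom C X Y; f' \<in> Hom C X Y; g \<in> Hom C Y Z\<rbrakk> \<Longrightarrow>
      g \<odot> plus_mor C f f' = plus_mor C (g \<odot> f) (g \<odot> f')"
    and plus_comp: "\<lbrakk>f \<in> Hom C X Y; g \<in> Hom C Y Z; g' \<in> Hom C Y Z\<rbrakk> \<Longrightarrow>
      plus_mor C g g' \<odot> f = plus_mor C (g \<odot> f) (g' \<odot> f)"

definition biproduct_of ::
    "('o, 'm, 'z) preadditive_category_scheme \<Rightarrow> 'o \<Rightarrow> 'o \<Rightarrow> 'o \<Rightarrow> bool"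
  where "biproduct_of C X Y Z \<longleftrightarrow>
    (\<exists>i \<in> Hom C X Z. \<exists>j \<in> Hom C Y Z. \<exists>p \<in> Hom C Z X. \<exists>q \<in> Hom C Z Y.
      p \<odot>\<^bsub>C\<^esub> i = ident C X \<and> q \<odot>\<^bsub>C\<^esub> j = ident C Y \<and>
      q \<odot>\<^bsub>C\<^esub> i = zero_mor C X Y \<and> p \<odot>\<^bsub>C\<^esub> j = zero_mor C Y X \<and>
      plus_mor C (i \<odot>\<^bsub>C\<^esub> p) (j \<odot>\<^bsub>C\<^esub> q) = ident C Z)"

locale additive_category = preadditive_category C
  for C :: "('o, 'm, 'z) preadditive_category_scheme" (structure) +
  assumes zero_obj_exists: "\<exists>Z. zero_obj C Z"
    and biproduct_exists:
      "\<lbrakk>X \<in> Ob C; Y \<in> Ob C\<rbrakk> \<Longrightarrow> \<exists>Z \<in> Ob C. biproduct_of C X Y Z"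

section \<open>Triangulated categories\<close>

record ('o, 'm) triangulated_category = "('o, 'm) preadditive_category" +
  susp_ob :: "'o \<Rightarrow> 'o"
  susp_mor :: "'m \<Rightarrow> 'm"
  triangles :: "('m \<times> 'm \<times> 'm) set"

definition candidate_triangle ::
    "('o, 'm, 'z) triangulated_category_scheme \<Rightarrow> 'o \<Rightarrow> 'o \<Rightarrow> 'o \<Rightarrow> 'm \<times> 'm \<times> 'm \<Rightarrow> bool"
  where "candidate_triangle K X Y Z = (\<lambda>(f, g, h).
    f \<in> Hom K X Y \<and> g \<in> Hom K Y Z \<and> h \<in> Hom K Z (susp_ob K X))"

text \<open>TR4 is the octahedral axiom. The suspension is only required to be an additive autoequivalence,
  not an automorphism.\<close>

locale triangulated_category = additive_category K
  for K :: "('o, 'm, 'z) triangulated_category_scheme" (structure) +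
  assumes susp_autoequivalence: "autoequivalence K (susp_ob K) (susp_mor K)"
    and susp_plus: "\<lbrakk>f \<in> Hom K X Y; g \<in> Hom K X Y\<rbrakk> \<Longrightarrow>
      susp_mor K (plus_mor K f g) = plus_mor K (susp_mor K f) (susp_mor K g)"
    and triangles_candidate: "t \<in> triangles K \<Longrightarrow> \<exists>X Y Z. candidate_triangle K X Y Z t"
    and TR1_iso: "\<lbrakk>(f, g, h) \<in> triangles K; candidate_triangle K X Y Z (f, g, h);
      candidate_triangle K X' Y' Z' (f', g', h');
      iso_mor K X X' u; iso_mor K Y Y' v; iso_mor K Z Z' w;
      v \<odot> f = f' \<odot> u; w \<odot> g = g' \<odot> v; susp_mor K u \<odot> h = h' \<odot> w\<rbrakk> \<Longrightarrow>
      (f', g', h') \<in> triangles K"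
    and TR1_ident: "\<lbrakk>X \<in> Ob K; zero_obj K Z\<rbrakk> \<Longrightarrow>
      (ident K X, zero_mor K X Z, zero_mor K Z (susp_ob K X)) \<in> triangles K"
    and TR1_cone: "f \<in> Mor K \<Longrightarrow> \<exists>g h. (f, g, h) \<in> triangles K"
    and TR2: "candidate_triangle K X Y Z (f, g, h) \<Longrightarrow>
      (f, g, h) \<in> triangles K \<longleftrightarrow> (g, h, neg_mor K (susp_mor K f)) \<in> triangles K"
    and TR3: "\<lbrakk>(f, g, h) \<in> triangles K; candidate_triangle K X Y Z (f, g, h);
      (f', g', h') \<in> triangles K; candidate_triangle K X' Y' Z' (f', g', h');
      u \<in> Hom K X X'; v \<in> Hom K Y Y'; v \<odot> f = f' \<odot> u\<rbrakk> \<Longrightarrow>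
      \<exists>w \<in> Hom K Z Z'. w \<odot> g = g' \<odot> v \<and> susp_mor K u \<odot> h = h' \<odot> w"
    and TR4: "\<lbrakk>f \<in> Hom K X Y; g \<in> Hom K Y Z;
      (f, i, i') \<in> triangles K; candidate_triangle K X Y U (f, i, i');
      (g, j, j') \<in> triangles K; candidate_triangle K Y Z W (g, j, j');
      (g \<odot> f, k, k') \<in> triangles K; candidate_triangle K X Z V (g \<odot> f, k, k')\<rbrakk> \<Longrightarrow>
      \<exists>a \<in> Hom K U V. \<exists>b \<in> Hom K V W.
        (a, b, susp_mor K i \<odot> j') \<in> triangles K \<and>
        a \<odot> i = k \<odot> g \<and> k' \<odot> a = i' \<and> b \<odot> k = j \<and> j' \<odot> b = susp_mor K f \<odot> k'"

section \<open>Thick subcategories\<close>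

text \<open>Full subcategories are represented by their sets of objects, and they are required to be
  nonempty, so that the least thick subcategory is the one of zero objects. Given closure under
  isomorphism, closure under all suspensions, i.e. under the suspension and its quasi-inverse,
  amounts to the equivalence in the fourth clause.\<close>

definition thick :: "('o, 'm, 'z) triangulated_category_scheme \<Rightarrow> 'o set \<Rightarrow> bool"
  where "thick K S \<longleftrightarrow> S \<subseteq> Ob K \<and> S \<noteq> {} \<and>
    (\<forall>X Y. iso_obj K X Y \<longrightarrow> X \<in> S \<longrightarrow> Y \<in> S) \<and>
    (\<forall>X \<in> Ob K. X \<in> S \<longleftrightarrow> susp_ob K X \<in> S) \<and>
    (\<forall>X Y Z f g h. (f, g, h) \<in> triangles K \<and> candidate_triangle K X Y Z (f, g, h) \<longrightarrow>
      X \<in> S \<longrightarrow> Y \<in> S \<longrightarrow> Z \<in> S) \<and>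
    (\<forall>X Y Z. biproduct_of K X Y Z \<longrightarrow> Z \<in> S \<longrightarrow> X \<in> S \<and> Y \<in> S)"

definition inclusion_order :: "'a set set \<Rightarrow> 'a set gorder"
  where "inclusion_order F = \<lparr>carrier = F, eq = (=), le = (\<subseteq>)\<rparr>"

definition thick_lattice ::
    "('o, 'm, 'z) triangulated_category_scheme \<Rightarrow> 'o set gorder"
  where "thick_lattice K = inclusion_order {S. thick K S}"

lemma partial_order_inclusion_order: "partial_order (inclusion_order F)"
  by unfold_locales (auto simp: inclusion_order_def)

lemma (in triangulated_category) thick_zero_obj:
  assumes "thick K S" "zero_obj K Z"
  shows "Z \<in> S"
proof -
  have "S \<subseteq> Ob K" "S \<noteq> {}"
    using assms(1) unfolding thick_def by blast+
  then obtain X where X: "X \<in> S" "X \<in> Ob K"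
    by blast
  have susp: "susp_ob K X \<in> Ob K"
    using susp_autoequivalence X by (auto simp: autoequivalence_def endofunctor_def)
  have Z: "Z \<in> Ob K"
    using assms(2) by (simp add: zero_obj_def)
  have zero: "zero_mor K A B \<in> Hom K A B" if "A \<in> Ob K" "B \<in> Ob K" for A B
    using comm_group.axioms(1)[OF hom_comm_group[OF that]] monoid.one_closed
    by (fastforce simp: hom_group_def comm_monoid_def)
  have "candidate_triangle K X X Z
      (ident K X, zero_mor K X Z, zero_mor K Z (susp_ob K X))"
    using zero X Z susp ident_closed by (auto simp: candidate_triangle_def)
  moreover have "(ident K X, zero_mor K X Z, zero_mor K Z (susp_ob K X)) \<in> triangles K"
    using TR1_ident X assms(2) by blast
  ultimately show ?thesis
    using assms(1) X(1) unfolding thick_def by blast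
qed

lemma (in triangulated_category) thick_Inter:
  assumes "\<And>S. S \<in> F \<Longrightarrow> thick K S" "F \<noteq> {}"
  shows "thick K (\<Inter>F)"
proof -
  have "\<Inter>F \<noteq> {}"
    using zero_obj_exists thick_zero_obj assms(1) by blast
  moreover have "\<Inter>F \<subseteq> Ob K"
    using assms unfolding thick_def by blast
  moreover have "\<forall>X Y. iso_obj K X Y \<longrightarrow> X \<in> \<Inter>F \<longrightarrow> Y \<in> \<Inter>F"
    using assms(1) unfolding thick_def by blast
  moreover have "\<forall>X \<in> Ob K. X \<in> \<Inter>F \<longleftrightarrow> susp_ob K X \<in> \<Inter>F"
    using assms(1) unfolding thick_def by blast
  moreover have "\<forall>X Y Z f g h. (f, g, h) \<in> triangles K \<and>
      candidate_triangle K X Y Z (f, g, h) \<longrightarrow> X \<in> \<Inter>F \<longrightarrow> Y \<in> \<Inter>F \<longrightarrow> Z \<in> \<Inter>F"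
    using assms(1) unfolding thick_def by blast
  moreover have "\<forall>X Y Z. biproduct_of K X Y Z \<longrightarrow> Z \<in> \<Inter>F \<longrightarrow> X \<in> \<Inter>F \<and> Y \<in> \<Inter>F"
    using assms(1) unfolding thick_def by blast
  ultimately show ?thesis
    unfolding thick_def by blast
qed

lemma (in triangulated_category) thick_Ob: "thick K (Ob K)"
proof -
  have susp: "susp_ob K X \<in> Ob K" if "X \<in> Ob K" for X
    using susp_autoequivalence that by (auto simp: autoequivalence_def endofunctor_def)
  have hom: "X \<in> Ob K \<and> Y \<in> Ob K" if "f \<in> Hom K X Y" for f X Y
    using that src_closed tgt_closed by (auto simp: Hom_def)
  show ?thesis
    using zero_obj_exists susp hom unfolding thick_def
    by (auto simp: iso_obj_def iso_mor_def candidate_triangle_def biproduct_of_def zero_obj_def)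
qed

lemma (in triangulated_category) complete_lattice_thick_lattice:
  "complete_lattice (thick_lattice K)"
proof -
  let ?L = "thick_lattice K"
  interpret partial_order ?L
    unfolding thick_lattice_def by (rule partial_order_inclusion_order)
  show ?thesis
  proof (rule complete_lattice_criterion1)
    show "\<exists>g. greatest ?L g (carrier ?L)"
      using thick_Ob
      by (auto simp: greatest_def thick_lattice_def inclusion_order_def thick_def
          intro!: exI[of _ "Ob K"])
    fix A assume A: "A \<subseteq> carrier ?L" "A \<noteq> {}"
    have "thick K (\<Inter>A)"
      using A by (intro thick_Inter) (auto simp: thick_lattice_def inclusion_order_def)
    then have "greatest ?L (\<Inter>A) (Lower ?L A)"
      using A by (auto simp: greatest_def Lower_def thick_lattice_def inclusion_order_def)
    then show "\<exists>i. greatest ?L i (Lower ?L A)"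
      by blast
  qed
qed

section \<open>Lattices and their spectra\<close>

locale distributive_lattice = lattice L for L (structure) +
  assumes meet_join_distrib: "\<lbrakk>x \<in> carrier L; y \<in> carrier L; z \<in> carrier L\<rbrakk> \<Longrightarrow>
    x \<sqinter> (y \<squnion> z) = (x \<sqinter> y) \<squnion> (x \<sqinter> z)"

definition lattice_isomorphic ::
    "('a, 'c) gorder_scheme \<Rightarrow> ('b, 'd) gorder_scheme \<Rightarrow> bool"
  where "lattice_isomorphic L M \<longleftrightarrow>
    (\<exists>\<phi>. bij_betw \<phi> (carrier L) (carrier M) \<and> join_pres L M \<phi> \<and> meet_pres L M \<phi>)"

definition meet_prime :: "('a, 'c) gorder_scheme \<Rightarrow> 'a \<Rightarrow> bool"
  where "meet_prime L P \<longleftrightarrow> P \<in> carrier L \<and> P \<noteq> \<top>\<^bsub>L\<^esub> \<and>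
    (\<forall>l \<in> carrier L. \<forall>m \<in> carrier L. l \<sqinter>\<^bsub>L\<^esub> m \<sqsubseteq>\<^bsub>L\<^esub> P \<longrightarrow> l \<sqsubseteq>\<^bsub>L\<^esub> P \<or> m \<sqsubseteq>\<^bsub>L\<^esub> P)"

text \<open>The two-element lattice is \<^typ>\<open>bool\<close>. Points are normalised to be \<^const>\<open>undefined\<close> outside the
  carrier.\<close>

definition spec_points :: "('a, 'c) gorder_scheme \<Rightarrow> ('a \<Rightarrow> bool) set"
  where "spec_points L = {p \<in> extensional (carrier L).
    (\<forall>a \<in> carrier L. \<forall>b \<in> carrier L. a \<sqsubseteq>\<^bsub>L\<^esub> b \<longrightarrow> p a \<le> p b) \<and>
    (\<forall>A \<subseteq> carrier L. finite A \<longrightarrow> p (\<Sqinter>\<^bsub>L\<^esub>A) = Inf (p ` A)) \<and>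
    (\<forall>A \<subseteq> carrier L. p (\<Squnion>\<^bsub>L\<^esub>A) = Sup (p ` A))}"

definition spec_open :: "('a, 'c) gorder_scheme \<Rightarrow> 'a \<Rightarrow> ('a \<Rightarrow> bool) set"
  where "spec_open L l = {p \<in> spec_points L. p l}"

definition Spec :: "('a, 'c) gorder_scheme \<Rightarrow> ('a \<Rightarrow> bool) topology"
  where "Spec L = topology (\<lambda>U. \<exists>l \<in> carrier L. U = spec_open L l)"

lemma spec_points_meet:
  assumes "p \<in> spec_points L" "l \<in> carrier L" "m \<in> carrier L"
  shows "p (l \<sqinter>\<^bsub>L\<^esub> m) \<longleftrightarrow> p l \<and> p m"
proof -
  have "{l, m} \<subseteq> carrier L" "finite {l, m}"
    using assms(2,3) by auto
  then have "p (\<Sqinter>\<^bsub>L\<^esub>{l, m}) = Inf (p ` {l, m})"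
    using assms(1) unfolding spec_points_def by blast
  then show ?thesis
    by (simp add: meet_def)
qed

lemma openin_Spec:
  assumes "complete_lattice L"
  shows "openin (Spec L) U \<longleftrightarrow> (\<exists>l \<in> carrier L. U = spec_open L l)"
proof -
  interpret complete_lattice L by fact
  let ?O = "\<lambda>U. \<exists>l \<in> carrier L. U = spec_open L l"
  have "istopology ?O"
    unfolding istopology_def
  proof (intro conjI allI impI)
    fix S T assume "?O S" "?O T"
    then obtain l m where lm: "l \<in> carrier L" "m \<in> carrier L" "S = spec_open L l" "T = spec_open L m"
      by blast
    have "S \<inter> T = spec_open L (l \<sqinter>\<^bsub>L\<^esub> m)"
      using lm by (auto simp: spec_open_def spec_points_meet)
    then show "?O (S \<inter> T)"
      using lm by auto
  next
    fix F assume F: "\<forall>S \<in> F. ?O S"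
    define A where "A = {l \<in> carrier L. spec_open L l \<in> F}"
    have A: "A \<subseteq> carrier L" by (auto simp: A_def)
    have "p (\<Squnion>\<^bsub>L\<^esub>A) \<longleftrightarrow> (\<exists>l \<in> A. p l)" if "p \<in> spec_points L" for p
      using that A unfolding spec_points_def by auto
    then have "spec_open L (\<Squnion>\<^bsub>L\<^esub>A) = (\<Union>l \<in> A. spec_open L l)"
      by (auto simp: spec_open_def)
    also have "\<dots> = \<Union>F"
      using F by (auto simp: A_def)
    finally show "?O (\<Union>F)"
      using A sup_closed by metis
  qed
  then show ?thesis
    by (simp add: Spec_def topology_inverse')
qed

lemma topspace_Spec:
  assumes "complete_lattice L"
  shows "topspace (Spec L) = spec_points L"
proof -
  interpret complete_lattice L by fact
  have "p (\<Sqinter>\<^bsub>L\<^esub>{})" if "p \<in> spec_points L" for p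
    using that by (simp add: spec_points_def)
  then have "spec_open L (\<Sqinter>\<^bsub>L\<^esub>{}) = spec_points L"
    by (auto simp: spec_open_def)
  then have "openin (Spec L) (spec_points L)"
    using openin_Spec[OF assms] inf_closed by (metis empty_subsetI)
  then show ?thesis
    using openin_Spec[OF assms] openin_subset openin_topspace
    by (metis (no_types, lifting) spec_open_def mem_Collect_eq subsetI subset_antisym)
qed

lemma bij_betw_meet_prime_spec_points:
  assumes "complete_lattice L"
  shows "bij_betw (\<lambda>P. \<lambda>a \<in> carrier L. \<not> a \<sqsubseteq>\<^bsub>L\<^esub> P) {P. meet_prime L P} (spec_points L)"
proof -
  interpret complete_lattice L by fact
  let ?\<Phi> = "\<lambda>P. \<lambda>a \<in> carrier L. \<not> a \<sqsubseteq>\<^bsub>L\<^esub> P"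
  have inj: "inj_on ?\<Phi> {P. meet_prime L P}"
  proof (rule inj_onI)
    fix P Q assume PQ: "P \<in> {P. meet_prime L P}" "Q \<in> {P. meet_prime L P}" "?\<Phi> P = ?\<Phi> Q"
    then have c: "P \<in> carrier L" "Q \<in> carrier L" by (auto simp: meet_prime_def)
    have "a \<sqsubseteq>\<^bsub>L\<^esub> P \<longleftrightarrow> a \<sqsubseteq>\<^bsub>L\<^esub> Q" if "a \<in> carrier L" for a
      using fun_cong[OF PQ(3), of a] that by simp
    then show "P = Q" using c le_antisym le_refl by blast
  qed
  have into: "?\<Phi> P \<in> spec_points L" if P: "meet_prime L P" for P
  proof -
    have c: "P \<in> carrier L" and ne: "P \<noteq> \<top>\<^bsub>L\<^esub>" using P by (auto simp: meet_prime_def)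
    have inf: "\<Sqinter>\<^bsub>L\<^esub>A \<sqsubseteq>\<^bsub>L\<^esub> P \<longleftrightarrow> (\<exists>a \<in> A. a \<sqsubseteq>\<^bsub>L\<^esub> P)" if "finite A" "A \<subseteq> carrier L" for A
      using that
    proof (induction A)
      case empty
      have "\<not> \<top>\<^bsub>L\<^esub> \<sqsubseteq>\<^bsub>L\<^esub> P"
        using c ne top_higher le_antisym top_closed by blast
      then show ?case
        using weak_inf_empty eq_is_equal by simp
    next
      case (insert a A)
      then have cs: "a \<in> carrier L" "A \<subseteq> carrier L" by auto
      have "\<Sqinter>\<^bsub>L\<^esub>(insert a A) = a \<sqinter>\<^bsub>L\<^esub> \<Sqinter>\<^bsub>L\<^esub>A"
        using weak_inf_insert[OF cs] eq_is_equal by simp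
      moreover have "a \<sqinter>\<^bsub>L\<^esub> \<Sqinter>\<^bsub>L\<^esub>A \<sqsubseteq>\<^bsub>L\<^esub> P \<longleftrightarrow> a \<sqsubseteq>\<^bsub>L\<^esub> P \<or> \<Sqinter>\<^bsub>L\<^esub>A \<sqsubseteq>\<^bsub>L\<^esub> P"
        using P cs c inf_closed[OF cs(2)] meet_left meet_right meet_closed le_trans
        unfolding meet_prime_def by meson
      ultimately show ?case using insert cs by simp
    qed
    have sup: "\<Squnion>\<^bsub>L\<^esub>A \<sqsubseteq>\<^bsub>L\<^esub> P \<longleftrightarrow> (\<forall>a \<in> A. a \<sqsubseteq>\<^bsub>L\<^esub> P)" if A: "A \<subseteq> carrier L" for A
      using A c sup_least sup_upper sup_closed le_trans by (meson subsetD)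
    have mono: "\<not> b \<sqsubseteq>\<^bsub>L\<^esub> P"
      if "a \<in> carrier L" "b \<in> carrier L" "a \<sqsubseteq>\<^bsub>L\<^esub> b" "\<not> a \<sqsubseteq>\<^bsub>L\<^esub> P" for a b
      using that c le_trans by blast
    have img: "?\<Phi> P ` A = (\<lambda>a. \<not> a \<sqsubseteq>\<^bsub>L\<^esub> P) ` A" if "A \<subseteq> carrier L" for A
      using that by (auto intro!: image_cong)
    have "?\<Phi> P (\<Sqinter>\<^bsub>L\<^esub>A) = Inf (?\<Phi> P ` A)" if "A \<subseteq> carrier L" "finite A" for A
      unfolding img[OF that(1)] using inf[OF that(2,1)] that(1) by simp
    moreover have "?\<Phi> P (\<Squnion>\<^bsub>L\<^esub>A) = Sup (?\<Phi> P ` A)" if "A \<subseteq> carrier L" for A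
      unfolding img[OF that] using sup[OF that] that by simp
    moreover have "?\<Phi> P a \<le> ?\<Phi> P b"
      if "a \<in> carrier L" "b \<in> carrier L" "a \<sqsubseteq>\<^bsub>L\<^esub> b" for a b
      using mono[OF that] that by simp
    ultimately show ?thesis
      unfolding spec_points_def by blast
  qed
  have onto: "\<exists>P. meet_prime L P \<and> ?\<Phi> P = p" if p: "p \<in> spec_points L" for p
  proof -
    define A where "A = {a \<in> carrier L. \<not> p a}"
    define P where "P = \<Squnion>\<^bsub>L\<^esub>A"
    have A: "A \<subseteq> carrier L" by (auto simp: A_def)
    have c: "P \<in> carrier L" using A by (simp add: P_def)
    have "p P = Sup (p ` A)"
      using p A unfolding spec_points_def P_def by blast
    then have nP: "\<not> p P" by (auto simp: A_def)
    have mono: "p b" if "a \<in> carrier L" "b \<in> carrier L" "a \<sqsubseteq>\<^bsub>L\<^esub> b" "p a" for a b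
      using p that unfolding spec_points_def by (auto simp: le_bool_def)
    have le: "a \<sqsubseteq>\<^bsub>L\<^esub> P \<longleftrightarrow> \<not> p a" if "a \<in> carrier L" for a
    proof
      assume "a \<sqsubseteq>\<^bsub>L\<^esub> P" then show "\<not> p a" using mono that c nP by blast
    next
      assume "\<not> p a" then show "a \<sqsubseteq>\<^bsub>L\<^esub> P"
        using that A sup_upper by (auto simp: P_def A_def)
    qed
    have "p (\<Sqinter>\<^bsub>L\<^esub>{})" using p by (simp add: spec_points_def)
    then have "P \<noteq> \<top>\<^bsub>L\<^esub>" using nP weak_inf_empty eq_is_equal by auto
    moreover have "p (l \<sqinter>\<^bsub>L\<^esub> m)" if "l \<in> carrier L" "m \<in> carrier L" "p l" "p m" for l m
      using spec_points_meet[OF p that(1,2)] that(3,4) by simp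
    ultimately have "meet_prime L P"
      using c le unfolding meet_prime_def by (metis meet_closed)
    moreover have "?\<Phi> P = p"
    proof
      fix a
      show "?\<Phi> P a = p a"
      proof (cases "a \<in> carrier L")
        case False
        moreover have "p \<in> extensional (carrier L)"
          using p by (simp add: spec_points_def)
        ultimately show ?thesis by (simp add: extensional_def)
      qed (simp add: le)
    qed
    ultimately show ?thesis by blast
  qed
  have "?\<Phi> ` {P. meet_prime L P} = spec_points L"
    using into onto by (fastforce simp: image_iff)
  then show ?thesis
    using inj by (simp add: bij_betw_def)
qed

section \<open>Sober spaces\<close>

definition irreducible_closedin :: "'a topology \<Rightarrow> 'a set \<Rightarrow> bool"
  where "irreducible_closedin X C \<longleftrightarrow> closedin X C \<and> C \<noteq> {} \<and>
    (\<forall>A B. closedin X A \<longrightarrow> closedin X B \<longrightarrow> C = A \<union> B \<longrightarrow> C = A \<or> C = B)"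

definition sober_space :: "'a topology \<Rightarrow> bool"
  where "sober_space X \<longleftrightarrow>
    (\<forall>C. irreducible_closedin X C \<longrightarrow> (\<exists>!x. x \<in> topspace X \<and> X closure_of {x} = C))"

definition open_lattice :: "'a topology \<Rightarrow> 'a set gorder"
  where "open_lattice X = inclusion_order {U. openin X U}"

end

theory Submission
  imports Defs
begin

text \<open>The theorem rests on \<open>Spec Thick(K)\<close> having enough points to separate the elements
  of \<open>Thick(K)\<close>. Given this, everything else is formal and holds over any complete lattice: the
  open sets are by definition the sets \<open>U_l\<close>, separation makes \<open>l \<mapsto> U_l\<close> an order isomorphism
  (lemma \<open>lattice_isomorphic_Spec\<close>), and the spectrum is always sober, because the complement of
  an irreducible closed set is some \<open>U_l\<close> whose largest index \<open>l\<close> is meet-prime and hence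
  a generic point (lemma \<open>sober_space_Spec\<close>).

  Separation comes from the finitary nature of thick closure. The axioms of a thick
  subcategory involve finitely many objects at a time, so the union of a nonempty chain of thick
  subcategories is thick (lemma \<open>thick_Union_chain\<close>). If \<open>M\<close> is thick and \<open>x \<notin> M\<close>, Zorn's lemma gives a
  thick \<open>P \<supseteq> M\<close> maximal with \<open>x \<notin> P\<close>. Suppose \<open>a \<sqinter> b \<subseteq> P\<close> although neither \<open>a\<close> nor \<open>b\<close> lies in \<open>P\<close>.
  By maximality \<open>x\<close> is an object of \<open>P \<squnion> a\<close> and of \<open>P \<squnion> b\<close>, hence of their meet, which is their
  intersection. By distributivity this meet is \<open>P \<squnion> (a \<sqinter> b) = P\<close>, a contradiction. Hence \<open>P\<close> is
  meet-prime (lemma \<open>meet_prime_separation\<close>).\<close>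

section \<open>Lattices of sets\<close>

lemma inclusion_order_simps [simp]:
  "carrier (inclusion_order F) = F"
  "le (inclusion_order F) = (\<subseteq>)"
  "eq (inclusion_order F) = (=)"
  by (simp_all add: inclusion_order_def)

lemma inclusion_order_least_Un:
  assumes "A \<in> F" "B \<in> F" "A \<union> B \<in> F"
  shows "least (inclusion_order F) (A \<union> B) (Upper (inclusion_order F) {A, B})"
  using assms by (auto simp: least_def Upper_def)

lemma inclusion_order_greatest_Int:
  assumes "A \<in> F" "B \<in> F" "A \<inter> B \<in> F"
  shows "greatest (inclusion_order F) (A \<inter> B) (Lower (inclusion_order F) {A, B})"
  using assms by (auto simp: greatest_def Lower_def)

lemma inclusion_order_meet:
  assumes "A \<in> F" "B \<in> F" "A \<inter> B \<in> F"
  shows "A \<sqinter>\<^bsub>inclusion_order F\<^esub> B = A \<inter> B"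
proof -
  interpret partial_order "inclusion_order F"
    by (rule partial_order_inclusion_order)
  show ?thesis
    unfolding meet_def inf_def
    using inclusion_order_greatest_Int[OF assms] greatest_unique
    by (intro some_equality) blast+
qed

lemma lattice_inclusion_order:
  assumes "\<And>A B. \<lbrakk>A \<in> F; B \<in> F\<rbrakk> \<Longrightarrow> A \<union> B \<in> F"
    and "\<And>A B. \<lbrakk>A \<in> F; B \<in> F\<rbrakk> \<Longrightarrow> A \<inter> B \<in> F"
  shows "lattice (inclusion_order F)"
proof -
  interpret partial_order "inclusion_order F"
    by (rule partial_order_inclusion_order)
  show ?thesis
  proof unfold_locales
    fix A B assume AB: "A \<in> carrier (inclusion_order F)" "B \<in> carrier (inclusion_order F)"
    show "\<exists>s. least (inclusion_order F) s (Upper (inclusion_order F) {A, B})"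
      using inclusion_order_least_Un[of A F B] AB assms by auto
    show "\<exists>s. greatest (inclusion_order F) s (Lower (inclusion_order F) {A, B})"
      using inclusion_order_greatest_Int[of A F B] AB assms by auto
  qed
qed

section \<open>Order isomorphisms\<close>

lemma lattice_isomorphicI_order:
  assumes "lattice L" "lattice M"
    and bij: "bij_betw \<phi> (carrier L) (carrier M)"
    and order: "\<And>x y. \<lbrakk>x \<in> carrier L; y \<in> carrier L\<rbrakk> \<Longrightarrow> \<phi> x \<sqsubseteq>\<^bsub>M\<^esub> \<phi> y \<longleftrightarrow> x \<sqsubseteq>\<^bsub>L\<^esub> y"
  shows "lattice_isomorphic L M"
proof -
  interpret L: lattice L by fact
  interpret M: lattice M by fact
  have closed: "\<phi> x \<in> carrier M" if "x \<in> carrier L" for x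
    using bij that by (auto simp: bij_betw_def)
  have surj: "\<exists>x \<in> carrier L. y = \<phi> x" if "y \<in> carrier M" for y
    using bij that by (auto simp: bij_betw_def)
  have "\<phi> (x \<squnion>\<^bsub>L\<^esub> y) = \<phi> x \<squnion>\<^bsub>M\<^esub> \<phi> y" if xy: "x \<in> carrier L" "y \<in> carrier L" for x y
  proof (rule M.le_antisym)
    obtain z where z: "z \<in> carrier L" "\<phi> x \<squnion>\<^bsub>M\<^esub> \<phi> y = \<phi> z"
      using surj[OF M.join_closed[OF closed closed]] xy by blast
    have "\<phi> x \<sqsubseteq>\<^bsub>M\<^esub> \<phi> z" "\<phi> y \<sqsubseteq>\<^bsub>M\<^esub> \<phi> z"
      unfolding z(2)[symmetric] using xy closed by (auto intro: M.join_left M.join_right)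
    then have "x \<sqsubseteq>\<^bsub>L\<^esub> z" "y \<sqsubseteq>\<^bsub>L\<^esub> z"
      using xy z(1) order by simp_all
    then show "\<phi> (x \<squnion>\<^bsub>L\<^esub> y) \<sqsubseteq>\<^bsub>M\<^esub> \<phi> x \<squnion>\<^bsub>M\<^esub> \<phi> y"
      using xy z L.join_le order by simp
    show "\<phi> x \<squnion>\<^bsub>M\<^esub> \<phi> y \<sqsubseteq>\<^bsub>M\<^esub> \<phi> (x \<squnion>\<^bsub>L\<^esub> y)"
      using xy L.join_left L.join_right order closed by (intro M.join_le) auto
  qed (use xy closed in auto)
  moreover have "\<phi> (x \<sqinter>\<^bsub>L\<^esub> y) = \<phi> x \<sqinter>\<^bsub>M\<^esub> \<phi> y" if xy: "x \<in> carrier L" "y \<in> carrier L" for x y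
  proof (rule M.le_antisym)
    obtain z where z: "z \<in> carrier L" "\<phi> x \<sqinter>\<^bsub>M\<^esub> \<phi> y = \<phi> z"
      using surj[OF M.meet_closed[OF closed closed]] xy by blast
    have "\<phi> z \<sqsubseteq>\<^bsub>M\<^esub> \<phi> x" "\<phi> z \<sqsubseteq>\<^bsub>M\<^esub> \<phi> y"
      unfolding z(2)[symmetric] using xy closed by (auto intro: M.meet_left M.meet_right)
    then have "z \<sqsubseteq>\<^bsub>L\<^esub> x" "z \<sqsubseteq>\<^bsub>L\<^esub> y"
      using xy z(1) order by simp_all
    then show "\<phi> x \<sqinter>\<^bsub>M\<^esub> \<phi> y \<sqsubseteq>\<^bsub>M\<^esub> \<phi> (x \<sqinter>\<^bsub>L\<^esub> y)"
      using xy z L.meet_le order by simp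
    show "\<phi> (x \<sqinter>\<^bsub>L\<^esub> y) \<sqsubseteq>\<^bsub>M\<^esub> \<phi> x \<sqinter>\<^bsub>M\<^esub> \<phi> y"
      using xy L.meet_left L.meet_right order closed by (intro M.meet_le) auto
  qed (use xy closed in auto)
  ultimately show ?thesis
    unfolding lattice_isomorphic_def join_pres_def meet_pres_def
    using assms(1,2) bij by blast
qed

section \<open>The spectrum of a complete lattice\<close>

lemma meet_prime_spec_point:
  assumes "complete_lattice L" "meet_prime L P"
  shows "(\<lambda>a \<in> carrier L. \<not> a \<sqsubseteq>\<^bsub>L\<^esub> P) \<in> spec_points L"
  using bij_betw_meet_prime_spec_points[OF assms(1)] assms(2)
  by (auto simp: bij_betw_def)

lemma spec_open_mono:
  assumes "l \<in> carrier L" "m \<in> carrier L" "l \<sqsubseteq>\<^bsub>L\<^esub> m"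
  shows "spec_open L l \<subseteq> spec_open L m"
  using assms unfolding spec_open_def spec_points_def by (auto simp: le_bool_def)

lemma spec_open_meet:
  assumes "l \<in> carrier L" "m \<in> carrier L"
  shows "spec_open L (l \<sqinter>\<^bsub>L\<^esub> m) = spec_open L l \<inter> spec_open L m"
  using assms by (auto simp: spec_open_def spec_points_meet)

lemma spec_open_Sup:
  assumes "A \<subseteq> carrier L"
  shows "spec_open L (\<Squnion>\<^bsub>L\<^esub>A) = (\<Union>l \<in> A. spec_open L l)"
proof -
  have "p (\<Squnion>\<^bsub>L\<^esub>A) \<longleftrightarrow> (\<exists>l \<in> A. p l)" if "p \<in> spec_points L" for p
    using that assms unfolding spec_points_def by auto
  then show ?thesis
    by (auto simp: spec_open_def)
qed

lemma in_closure_of_Spec_point: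
  assumes "complete_lattice L" "p \<in> spec_points L"
  shows "q \<in> Spec L closure_of {p} \<longleftrightarrow> q \<in> spec_points L \<and> (\<forall>a \<in> carrier L. q a \<longrightarrow> p a)"
proof -
  have "q \<in> Spec L closure_of {p} \<longleftrightarrow>
      q \<in> spec_points L \<and> (\<forall>a \<in> carrier L. q \<in> spec_open L a \<longrightarrow> p \<in> spec_open L a)"
    unfolding in_closure_of topspace_Spec[OF assms(1)] openin_Spec[OF assms(1)] by blast
  then show ?thesis
    using assms(2) by (auto simp: spec_open_def)
qed

text \<open>The closure of a point \<open>p\<close> consists of the points below \<open>p\<close>, so it determines \<open>p\<close> on the carrier,
  and points are normalised elsewhere.\<close>

lemma Spec_point_eqI:
  assumes L: "complete_lattice L" and pq: "p \<in> spec_points L" "q \<in> spec_points L"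
    and eq: "Spec L closure_of {p} = Spec L closure_of {q}"
  shows "p = q"
proof -
  have "p \<in> Spec L closure_of {p}" "q \<in> Spec L closure_of {q}"
    by (simp_all add: in_closure_of_Spec_point[OF L] pq)
  then have "p \<in> Spec L closure_of {q}" "q \<in> Spec L closure_of {p}"
    by (simp_all add: eq)
  then have "p a = q a" if "a \<in> carrier L" for a
    using that by (auto simp: in_closure_of_Spec_point[OF L] pq)
  moreover have "p \<in> extensional (carrier L)" "q \<in> extensional (carrier L)"
    using pq by (auto simp: spec_points_def)
  ultimately show ?thesis
    by (intro extensionalityI)
qed

text \<open>For the generic point of an irreducible closed set \<open>C\<close>, take the largest \<open>l\<close> such that \<open>U_l\<close> misses
  \<open>C\<close>. As \<open>C\<close> is not a union of two smaller closed sets, two basic open sets that meet \<open>C\<close> also meet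
  each other inside \<open>C\<close>, and this says that \<open>l\<close> is meet-prime.\<close>

lemma sober_space_Spec:
  assumes L: "complete_lattice L"
  shows "sober_space (Spec L)"
  unfolding sober_space_def
proof (intro allI impI)
  interpret complete_lattice L by fact
  fix C assume "irreducible_closedin (Spec L) C"
  then have C: "closedin (Spec L) C" "C \<noteq> {}"
    and irred: "\<And>A B. \<lbrakk>closedin (Spec L) A; closedin (Spec L) B; C = A \<union> B\<rbrakk> \<Longrightarrow> C = A \<or> C = B"
    unfolding irreducible_closedin_def by auto
  have Csub: "C \<subseteq> spec_points L"
    using closedin_subset[OF C(1)] topspace_Spec[OF L] by simp
  obtain k where k: "k \<in> carrier L" "spec_points L - C = spec_open L k"
    using C(1) unfolding closedin_def openin_Spec[OF L] topspace_Spec[OF L] by auto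
  define A where "A = {a \<in> carrier L. spec_open L a \<inter> C = {}}"
  define l where "l = \<Squnion>\<^bsub>L\<^esub>A"
  have A: "A \<subseteq> carrier L" by (auto simp: A_def)
  have l: "l \<in> carrier L" using A by (simp add: l_def)
  have l_disjoint: "spec_open L l \<inter> C = {}"
    unfolding l_def spec_open_Sup[OF A] by (auto simp: A_def)
  have le_l: "a \<sqsubseteq>\<^bsub>L\<^esub> l \<longleftrightarrow> spec_open L a \<inter> C = {}" if a: "a \<in> carrier L" for a
  proof
    assume "a \<sqsubseteq>\<^bsub>L\<^esub> l"
    then show "spec_open L a \<inter> C = {}"
      using spec_open_mono[OF a l] l_disjoint by blast
  next
    assume "spec_open L a \<inter> C = {}"
    then show "a \<sqsubseteq>\<^bsub>L\<^esub> l"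
      using a A sup_upper by (auto simp: l_def A_def)
  qed
  have closed: "closedin (Spec L) (C - spec_open L a)" if "a \<in> carrier L" for a
    using C(1) that by (intro closedin_diff) (auto simp: openin_Spec[OF L])
  have "meet_prime L l"
    unfolding meet_prime_def
  proof (intro conjI ballI impI)
    show "l \<in> carrier L" by (fact l)
    have "\<Sqinter>\<^bsub>L\<^esub>{} = \<top>\<^bsub>L\<^esub>"
      using weak_inf_empty eq_is_equal by simp
    then have "p \<top>\<^bsub>L\<^esub>" if "p \<in> spec_points L" for p
      using that by (auto simp: spec_points_def)
    then have "spec_open L \<top>\<^bsub>L\<^esub> = spec_points L"
      by (auto simp: spec_open_def)
    then show "l \<noteq> \<top>\<^bsub>L\<^esub>"
      using l_disjoint C(2) Csub by auto
  next
    fix a b assume ab: "a \<in> carrier L" "b \<in> carrier L" and "a \<sqinter>\<^bsub>L\<^esub> b \<sqsubseteq>\<^bsub>L\<^esub> l"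
    then have "C = (C - spec_open L a) \<union> (C - spec_open L b)"
      using le_l[of "a \<sqinter>\<^bsub>L\<^esub> b"] by (auto simp: spec_open_meet)
    then have "C = C - spec_open L a \<or> C = C - spec_open L b"
      by (intro irred closed ab)
    then show "a \<sqsubseteq>\<^bsub>L\<^esub> l \<or> b \<sqsubseteq>\<^bsub>L\<^esub> l"
      using le_l ab by blast
  qed
  define x where "x = (\<lambda>a \<in> carrier L. \<not> a \<sqsubseteq>\<^bsub>L\<^esub> l)"
  have x: "x \<in> spec_points L"
    unfolding x_def using L \<open>meet_prime L l\<close> by (rule meet_prime_spec_point)
  have generic: "Spec L closure_of {x} = C"
  proof (intro Set.set_eqI iffI)
    fix q assume "q \<in> Spec L closure_of {x}"
    then have q: "q \<in> spec_points L" "\<forall>a \<in> carrier L. q a \<longrightarrow> x a"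
      unfolding in_closure_of_Spec_point[OF L x] by auto
    have "k \<sqsubseteq>\<^bsub>L\<^esub> l"
      using le_l[OF k(1)] k(2) by blast
    then have "q \<notin> spec_open L k"
      using q k(1) by (auto simp: spec_open_def x_def)
    then show "q \<in> C"
      using q(1) k(2) by blast
  next
    fix q assume q: "q \<in> C"
    then have "\<not> a \<sqsubseteq>\<^bsub>L\<^esub> l" if "a \<in> carrier L" "q a" for a
      using le_l[OF that(1)] that(2) Csub by (auto simp: spec_open_def)
    then show "q \<in> Spec L closure_of {x}"
      unfolding in_closure_of_Spec_point[OF L x] using q Csub by (auto simp: x_def)
  qed
  show "\<exists>!x. x \<in> topspace (Spec L) \<and> Spec L closure_of {x} = C"
    unfolding topspace_Spec[OF L]
  proof (rule ex1I[of _ x])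
    show "x \<in> spec_points L \<and> Spec L closure_of {x} = C"
      using x generic by simp
    show "y = x" if "y \<in> spec_points L \<and> Spec L closure_of {y} = C" for y
      using that x generic by (intro Spec_point_eqI[OF L]) auto
  qed
qed

text \<open>If \<open>l\<close> is not below \<open>m\<close>, a meet-prime element above \<open>m\<close> but not above \<open>l\<close> is a point of \<open>U_l\<close>
  outside \<open>U_m\<close>. So \<open>l \<mapsto> U_l\<close> reflects the order.\<close>

lemma lattice_isomorphic_Spec:
  assumes L: "complete_lattice L"
    and separation: "\<And>l m. \<lbrakk>l \<in> carrier L; m \<in> carrier L; \<not> l \<sqsubseteq>\<^bsub>L\<^esub> m\<rbrakk> \<Longrightarrow>
      \<exists>P. meet_prime L P \<and> m \<sqsubseteq>\<^bsub>L\<^esub> P \<and> \<not> l \<sqsubseteq>\<^bsub>L\<^esub> P"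
  shows "lattice_isomorphic L (open_lattice (Spec L))"
proof (rule lattice_isomorphicI_order)
  interpret complete_lattice L by fact
  show "lattice L" ..
  show "lattice (open_lattice (Spec L))"
    unfolding open_lattice_def by (rule lattice_inclusion_order) auto
  have order: "spec_open L l \<subseteq> spec_open L m \<longleftrightarrow> l \<sqsubseteq>\<^bsub>L\<^esub> m"
    if lm: "l \<in> carrier L" "m \<in> carrier L" for l m
  proof
    assume sub: "spec_open L l \<subseteq> spec_open L m"
    show "l \<sqsubseteq>\<^bsub>L\<^esub> m"
    proof (rule ccontr)
      assume "\<not> l \<sqsubseteq>\<^bsub>L\<^esub> m"
      then obtain P where P: "meet_prime L P" "m \<sqsubseteq>\<^bsub>L\<^esub> P" "\<not> l \<sqsubseteq>\<^bsub>L\<^esub> P"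
        using separation lm by blast
      let ?p = "\<lambda>a \<in> carrier L. \<not> a \<sqsubseteq>\<^bsub>L\<^esub> P"
      have "?p \<in> spec_open L l" "?p \<notin> spec_open L m"
        using meet_prime_spec_point[OF L P(1)] P(2,3) lm by (auto simp: spec_open_def)
      then show False
        using sub by blast
    qed
  qed (rule spec_open_mono[OF lm])
  then show "spec_open L l \<sqsubseteq>\<^bsub>open_lattice (Spec L)\<^esub> spec_open L m \<longleftrightarrow> l \<sqsubseteq>\<^bsub>L\<^esub> m"
    if "l \<in> carrier L" "m \<in> carrier L" for l m
    using that by (simp add: open_lattice_def)
  have "inj_on (spec_open L) (carrier L)"
    using order le_antisym by (intro inj_onI) blast
  then show "bij_betw (spec_open L) (carrier L) (carrier (open_lattice (Spec L)))"
    using openin_Spec[OF L] by (auto simp: bij_betw_def open_lattice_def)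
qed

section \<open>Separation by meet-prime elements\<close>

text \<open>Distributing twice leaves the joinands \<open>(p \<squnion> a) \<sqinter> p\<close>, \<open>b \<sqinter> p\<close> and \<open>b \<sqinter> a\<close>, all below \<open>p\<close>.\<close>

lemma (in distributive_lattice) meet_of_joins_le:
  assumes "p \<in> carrier L" "a \<in> carrier L" "b \<in> carrier L" "a \<sqinter> b \<sqsubseteq> p"
  shows "(p \<squnion> a) \<sqinter> (p \<squnion> b) \<sqsubseteq> p"
proof -
  have "b \<sqinter> (p \<squnion> a) \<sqsubseteq> p"
    using assms meet_right by (auto simp: meet_join_distrib meet_comm[of L b a] intro!: join_le)
  then have "(p \<squnion> a) \<sqinter> b \<sqsubseteq> p"
    by (simp add: meet_comm)
  then show ?thesis
    using assms meet_right by (auto simp: meet_join_distrib intro!: join_le)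
qed

text \<open>A lattice of open sets satisfies an infinite distributive law, while only the finite one is
  assumed here. Closure under unions of chains bridges the gap: it makes \<open>P\<close>, maximal among the
  members of \<open>F\<close> that contain \<open>M\<close> but not \<open>x\<close>, available.\<close>

lemma meet_prime_separation:
  assumes dist: "distributive_lattice (inclusion_order F)"
    and Int: "\<And>A B. \<lbrakk>A \<in> F; B \<in> F\<rbrakk> \<Longrightarrow> A \<inter> B \<in> F"
    and chain: "\<And>\<C>. \<lbrakk>\<C> \<noteq> {}; subset.chain F \<C>\<rbrakk> \<Longrightarrow> \<Union>\<C> \<in> F"
    and top: "T \<in> F" "\<And>A. A \<in> F \<Longrightarrow> A \<subseteq> T"
    and M: "M \<in> F" "x \<notin> M" "x \<in> T"
  shows "\<exists>P. meet_prime (inclusion_order F) P \<and> M \<subseteq> P \<and> x \<notin> P"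
proof -
  interpret distributive_lattice "inclusion_order F" by fact
  let ?L = "inclusion_order F"
  let ?A = "{A \<in> F. M \<subseteq> A \<and> x \<notin> A}"
  have "\<exists>P \<in> ?A. \<forall>A \<in> ?A. P \<subseteq> A \<longrightarrow> A = P"
  proof (rule subset_Zorn_nonempty)
    show "?A \<noteq> {}" using M by blast
    fix \<C> assume ne: "\<C> \<noteq> {}" and ch: "subset.chain ?A \<C>"
    then have "\<Union>\<C> \<in> F"
      by (intro chain) (auto simp: subset_chain_def)
    then show "\<Union>\<C> \<in> ?A"
      using ne ch by (fastforce simp: subset_chain_def)
  qed
  then obtain P where "P \<in> ?A" and maximal: "\<forall>A \<in> ?A. P \<subseteq> A \<longrightarrow> A = P"
    by (rule bexE)
  then have P: "P \<in> F" "M \<subseteq> P" "x \<notin> P"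
    by simp_all
  have max: "A = P" if "A \<in> F" "P \<subseteq> A" "x \<notin> A" for A
    using maximal that subset_trans[OF P(2) that(2)] by simp
  have x_join: "x \<in> P \<squnion>\<^bsub>?L\<^esub> a" if a: "a \<in> F" "\<not> a \<subseteq> P" for a
  proof (rule ccontr)
    assume "x \<notin> P \<squnion>\<^bsub>?L\<^esub> a"
    then have "P \<squnion>\<^bsub>?L\<^esub> a = P"
      using max[of "P \<squnion>\<^bsub>?L\<^esub> a"] join_closed[of P a] join_left[of P a] P(1) a(1) by simp
    then show False
      using join_right[of P a] P(1) a by simp
  qed
  have "meet_prime ?L P"
    unfolding meet_prime_def
  proof (intro conjI ballI impI)
    show "P \<in> carrier ?L" using P by simp
    have greatest: "greatest ?L T (carrier ?L)"
      using top by (auto simp: greatest_def)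
    then have "\<top>\<^bsub>?L\<^esub> = T"
      unfolding top_def by (rule some_equality) (rule greatest_unique[OF _ greatest])
    then show "P \<noteq> \<top>\<^bsub>?L\<^esub>" using P(3) M(3) by blast
  next
    fix a b assume ab: "a \<in> carrier ?L" "b \<in> carrier ?L" and le: "a \<sqinter>\<^bsub>?L\<^esub> b \<sqsubseteq>\<^bsub>?L\<^esub> P"
    show "a \<sqsubseteq>\<^bsub>?L\<^esub> P \<or> b \<sqsubseteq>\<^bsub>?L\<^esub> P"
    proof (rule ccontr)
      assume "\<not> (a \<sqsubseteq>\<^bsub>?L\<^esub> P \<or> b \<sqsubseteq>\<^bsub>?L\<^esub> P)"
      then have x: "x \<in> (P \<squnion>\<^bsub>?L\<^esub> a) \<inter> (P \<squnion>\<^bsub>?L\<^esub> b)"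
        using x_join[of a] x_join[of b] ab by simp
      have cl: "P \<squnion>\<^bsub>?L\<^esub> a \<in> F" "P \<squnion>\<^bsub>?L\<^esub> b \<in> F"
        using join_closed[of P a] join_closed[of P b] P(1) ab by simp_all
      have "(P \<squnion>\<^bsub>?L\<^esub> a) \<inter> (P \<squnion>\<^bsub>?L\<^esub> b) \<subseteq> P"
        using meet_of_joins_le[of P a b] P(1) ab le
        unfolding inclusion_order_meet[OF cl Int[OF cl]] by simp
      then show False
        using x P(3) by blast
    qed
  qed
  then show ?thesis using P(2,3) by (intro exI[of _ P]) simp
qed

section \<open>Thick subcategories\<close>

lemma chain_two_members:
  assumes "subset.chain F \<C>" "X \<in> \<Union>\<C>" "Y \<in> \<Union>\<C>"
  obtains S where "S \<in> \<C>" "X \<in> S" "Y \<in> S"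
  using assms unfolding subset_chain_def by blast

lemma thickD:
  assumes "thick K S"
  shows "S \<subseteq> Ob K"
    and "S \<noteq> {}"
    and "\<forall>X Y. iso_obj K X Y \<longrightarrow> X \<in> S \<longrightarrow> Y \<in> S"
    and "\<forall>X \<in> Ob K. X \<in> S \<longleftrightarrow> susp_ob K X \<in> S"
    and "\<forall>X Y Z f g h. (f, g, h) \<in> triangles K \<and> candidate_triangle K X Y Z (f, g, h) \<longrightarrow>
      X \<in> S \<longrightarrow> Y \<in> S \<longrightarrow> Z \<in> S"
    and "\<forall>X Y Z. biproduct_of K X Y Z \<longrightarrow> Z \<in> S \<longrightarrow> X \<in> S \<and> Y \<in> S"
  using assms unfolding thick_def by - (elim conjE, assumption)+

text \<open>A clause with a single object in its hypothesis passes to any union. Closure under cones is the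
  only one with two; in a chain both already lie in one member.\<close>

lemma thick_Union_chain:
  assumes ne: "\<C> \<noteq> {}" and chain: "subset.chain {S. thick K S} \<C>"
  shows "thick K (\<Union>\<C>)"
proof -
  have members: "thick K S" if "S \<in> \<C>" for S
    using chain that by (auto simp: subset_chain_def)
  note thick = thickD[OF members]
  show ?thesis
    unfolding thick_def
  proof (intro conjI)
    show "\<Union>\<C> \<noteq> {}"
      using ne thick(2) by blast
    show "\<Union>\<C> \<subseteq> Ob K"
      using thick(1) by (rule Union_least)
    show "\<forall>X Y. iso_obj K X Y \<longrightarrow> X \<in> \<Union>\<C> \<longrightarrow> Y \<in> \<Union>\<C>"
      using thick(3) by blast
    show "\<forall>X \<in> Ob K. X \<in> \<Union>\<C> \<longleftrightarrow> susp_ob K X \<in> \<Union>\<C>"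
      using thick(4) by blast
    show "\<forall>X Y Z. biproduct_of K X Y Z \<longrightarrow> Z \<in> \<Union>\<C> \<longrightarrow> X \<in> \<Union>\<C> \<and> Y \<in> \<Union>\<C>"
      using thick(6) by blast
    show "\<forall>X Y Z f g h. (f, g, h) \<in> triangles K \<and>
      candidate_triangle K X Y Z (f, g, h) \<longrightarrow> X \<in> \<Union>\<C> \<longrightarrow> Y \<in> \<Union>\<C> \<longrightarrow> Z \<in> \<Union>\<C>"
    proof (intro allI impI)
      fix X Y Z f g h
      assume t: "(f, g, h) \<in> triangles K \<and> candidate_triangle K X Y Z (f, g, h)"
        and XY: "X \<in> \<Union>\<C>" "Y \<in> \<Union>\<C>"
      obtain S where S: "S \<in> \<C>" "X \<in> S" "Y \<in> S"
        by (rule chain_two_members[OF chain XY])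
      then have "Z \<in> S"
        using thick(5)[OF S(1)] t by blast
      then show "Z \<in> \<Union>\<C>"
        using S(1) by blast
    qed
  qed
qed

theorem corollary4p3p3:
  fixes K :: "('o, 'm, 'z) triangulated_category_scheme"
  assumes "triangulated_category K"
    and "distributive_lattice (thick_lattice K)"
  shows "sober_space (Spec (thick_lattice K)) \<and>
    lattice_isomorphic (thick_lattice K) (open_lattice (Spec (thick_lattice K)))"
proof
  interpret triangulated_category K by fact
  let ?L = "thick_lattice K"
  have L: "complete_lattice ?L"
    by (rule complete_lattice_thick_lattice)
  show "sober_space (Spec ?L)"
    using L by (rule sober_space_Spec)
  show "lattice_isomorphic ?L (open_lattice (Spec ?L))"
  proof (rule lattice_isomorphic_Spec[OF L])
    fix l m assume lm: "l \<in> carrier ?L" "m \<in> carrier ?L" "\<not> l \<sqsubseteq>\<^bsub>?L\<^esub> m"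
    then have thick: "thick K l" "thick K m" and "\<not> l \<subseteq> m"
      by (simp_all add: thick_lattice_def)
    then obtain x where x: "x \<in> l" "x \<notin> m"
      by blast
    have "\<exists>P. meet_prime (inclusion_order {S. thick K S}) P \<and> m \<subseteq> P \<and> x \<notin> P"
    proof (rule meet_prime_separation[where T = "Ob K"])
      show "distributive_lattice (inclusion_order {S. thick K S})"
        using assms(2) by (simp add: thick_lattice_def)
      show "A \<inter> B \<in> {S. thick K S}" if "A \<in> {S. thick K S}" "B \<in> {S. thick K S}" for A B
        using thick_Inter[of "{A, B}"] that by auto
      show "\<Union>\<C> \<in> {S. thick K S}" if "\<C> \<noteq> {}" "subset.chain {S. thick K S} \<C>" for \<C>
        using thick_Union_chain[OF that] by simp
      show "x \<in> Ob K"
        using x(1) thickD(1)[OF thick(1)] by blast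
    qed (use thick(2) thick_Ob x(2) thickD(1) in \<open>simp_all\<close>)
    then show "\<exists>P. meet_prime ?L P \<and> m \<sqsubseteq>\<^bsub>?L\<^esub> P \<and> \<not> l \<sqsubseteq>\<^bsub>?L\<^esub> P"
      using x by (auto simp: thick_lattice_def)
  qed
qed

end
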